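(* Let $(\mathcal{X},d_{\mathcal{X}})$ be a compact metric space with diameter $T_{\mathcal{X}}$, $(\mathcal{Y},d_{\mathcal{Y}})$ a metric space, $f\colon\mathcal{X}\to\mathcal{Y}$ continuous, and $[a,b]\subset(0,T_{\mathcal{X}}]$. Let $0<r\leq a$, $N_r\geq\mathcal{N}(\mathcal{X},r/2)$, and let $X_{N_r}=\{x_1,\ldots,x_{N_r}\}\subset\mathcal{X}$ be an $r/2$-net for $\mathcal{X}$. Then, for $p\in[1,\infty)$, $$\|\omega(f,\cdot)-\omega_{N_r}(f,\cdot)\|_{L^p(a,b)}\leq 2^{\frac{p-1}{p}}\|\omega(f,\cdot)-\omega(f,\cdot-r)\|_{L^p(a,b)}+2(b-a)^{1/p}\omega(f,r),$$ and for $p=\infty$, $$\|\omega(f,\cdot)-\omega_{N_r}(f,\cdot)\|_{L^\infty(a,b)}\leq\|\omega(f,\cdot)-\omega(f,\cdot-r)\|_{L^\infty(a,b)}+2\,\omega(f,r).$$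
   Context: $B_\varepsilon(x')=\{x\in\mathcal{X}: d_{\mathcal{X}}(x,x')\leq\varepsilon\}$ denotes the closed ball. An $\varepsilon$-net for $\mathcal{X}$ is a subset $\mathcal{K}\subset\mathcal{X}$ such that each $x\in\mathcal{X}$ lies in $B_\varepsilon(x')$ for some $x'\in\mathcal{K}$; the covering number $\mathcal{N}(\mathcal{X},\varepsilon)$ is the smallest cardinality of an $\varepsilon$-net for $\mathcal{X}$. The modulus of continuity is $\omega(f,t)=\sup\{d_{\mathcal{Y}}(f(x),f(x')): x,x'\in\mathcal{X},\ d_{\mathcal{X}}(x,x')\leq t\}$ for $t\in[0,\infty]$, and $\omega(f,\cdot-r)$ denotes the function $t\mapsto\omega(f,t-r)$. The discrete modulus of continuity with respect to a finite set $X_N\subset\mathcal{X}$ of data sites is $\omega_N(f,t)=\max\{d_{\mathcal{Y}}(f(x_i),f(x_j)): x_i,x_j\in X_N,\ d_{\mathcal{X}}(x_i,x_j)\leq t\}$. $L^p(a,b)$ is with respect to Lebesgue measure in $t$. *)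

theory Defs
  imports "HOL-Analysis.Analysis" "HOL-Probability.Essential_Supremum"
begin

definition eps_net :: "'a::metric_space set \<Rightarrow> real \<Rightarrow> 'a set \<Rightarrow> bool" where
  "eps_net S \<epsilon> K \<longleftrightarrow> K \<subseteq> S \<and> (\<forall>x\<in>S. \<exists>x'\<in>K. x \<in> cball x' \<epsilon>)"

text \<open>The infimum is taken in \<^typ>\<open>enat\<close>, hence attained, and it is \<open>\<infinity>\<close> if there
  is no finite \<open>\<epsilon>\<close>-net.\<close>

definition covering_number :: "'a::metric_space set \<Rightarrow> real \<Rightarrow> enat" where
  "covering_number S \<epsilon> = (INF K\<in>{K. finite K \<and> eps_net S \<epsilon> K}. enat (card K))"

text \<open>The scale ranges over \<open>[0, \<infinity>]\<close>. The supremum is a real one: it is meaningful if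
  the set of distances is bounded (for instance if \<open>S\<close> is compact and \<open>f\<close> is continuous on \<open>S\<close>),
  \<open>S\<close> is nonempty and \<open>t \<ge> 0\<close>.\<close>

definition modulus_of_continuity ::
  "'a::metric_space set \<Rightarrow> ('a \<Rightarrow> 'b::metric_space) \<Rightarrow> ereal \<Rightarrow> real" where
  "modulus_of_continuity S f t =
     Sup {dist (f x) (f x') | x x'. x \<in> S \<and> x' \<in> S \<and> ereal (dist x x') \<le> t}"

text \<open>Here the set \<open>X\<close> of data sites is meant to be finite and nonempty, and \<open>t \<ge> 0\<close>.\<close>

definition discrete_modulus ::
  "'a::metric_space set \<Rightarrow> ('a \<Rightarrow> 'b::metric_space) \<Rightarrow> ereal \<Rightarrow> real" where
  "discrete_modulus X f t =
     Max {dist (f x) (f x') | x x'. x \<in> X \<and> x' \<in> X \<and> ereal (dist x x') \<le> t}"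

definition ennreal_powr :: "ennreal \<Rightarrow> real \<Rightarrow> ennreal" where
  "ennreal_powr x q = (if x = \<infinity> then \<infinity> else ennreal (enn2real x powr q))"

text \<open>The norms take values in \<open>[0, \<infinity>]\<close>, so that no integrability or boundedness is built
  into an inequality between them.\<close>

definition Lp_norm :: "real \<Rightarrow> real \<Rightarrow> real \<Rightarrow> (real \<Rightarrow> real) \<Rightarrow> ennreal" where
  "Lp_norm p a b g =
     ennreal_powr (\<integral>\<^sup>+ t. ennreal (\<bar>g t\<bar> powr p) \<partial>lebesgue_on {a<..<b}) (1 / p)"

definition Linf_norm :: "real \<Rightarrow> real \<Rightarrow> (real \<Rightarrow> real) \<Rightarrow> ennreal" where
  "Linf_norm a b g = esssup (lebesgue_on {a<..<b}) (\<lambda>t. ennreal \<bar>g t\<bar>)"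

end

theory Submission
  imports Defs
begin

text \<open>Moving two points at distance at most \<open>t - r\<close> to net points within \<open>r/2\<close> gives
  \<open>\<omega>(f, t - r) \<le> \<omega>\<^sub>N(f, t) + 2 \<omega>(f, r)\<close>, hence
  \<open>0 \<le> \<omega>(f, t) - \<omega>\<^sub>N(f, t) \<le> (\<omega>(f, t) - \<omega>(f, t - r)) + 2 \<omega>(f, r)\<close> on \<open>(a, b)\<close>.
  The bounds on the norms follow from Minkowski's inequality, because
  \<open>2 powr ((p - 1) / p) \<ge> 1\<close>. Minkowski's inequality in turn comes from integrating the
  convexity of \<open>u \<mapsto> u powr p\<close> at \<open>u + v = (U + V) (U/(U+V) (u/U) + V/(U+V) (v/V))\<close>, where \<open>U\<close> and
  \<open>V\<close> are the norms of \<open>u\<close> and \<open>v\<close>.\<close>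

section \<open>Minkowski-type bounds for both norms with a constant summand\<close>

lemma powr_convex_combination_le:
  fixes x y l p :: real
  assumes "1 \<le> p" "0 \<le> x" "0 \<le> y" "0 \<le> l" "l \<le> 1"
  shows "(l * x + (1 - l) * y) powr p \<le> l * x powr p + (1 - l) * y powr p"
proof -
  \<comment> \<open>Convexity on the open half-line settles positive \<open>x\<close> and
    \<open>y\<close>. If one of them is 0, what remains follows from \<open>m powr p \<le> m\<close>
    for a weight \<open>m\<close> in [0, 1].\<close>
  have scale: "(m * z) powr p \<le> m * z powr p" if "0 \<le> m" "m \<le> 1" "0 \<le> z" for m z :: real
  proof -
    have "m powr p \<le> m"
      using powr_mono'[of 1 p m] that assms(1) by simp
    then show ?thesis
      using that by (simp add: powr_mult mult_right_mono)
  qed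
  consider "x = 0" | "y = 0" | "x > 0" "y > 0"
    using assms by linarith
  then show ?thesis
  proof cases
    case 1
    then show ?thesis using scale[of "1 - l" y] assms by simp
  next
    case 2
    then show ?thesis using scale[of l x] assms by simp
  next
    case 3
    then show ?thesis
      using convex_onD[OF powr_convex[OF assms(1)], of "1 - l" x y] assms by simp
  qed
qed

text \<open>The right-hand side is linear in \<open>u powr p\<close> and \<open>v powr p\<close>, so
  it can be integrated termwise; if \<open>U\<close> and \<open>V\<close> are the norms, the bracket
  integrates to the sum of the weights, which is 1.\<close>

lemma powr_add_le_weighted:
  fixes u v U V p :: real
  assumes "1 \<le> p" "0 \<le> u" "0 \<le> v" "0 < U" "0 < V"
  shows "(u + v) powr p
           \<le> (U + V) powr p * (U / (U + V) * (u powr p / U powr p) + V / (U + V) * (v powr p / V powr p))"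
proof -
  define l where "l = U / (U + V)"
  have l: "0 \<le> l" "l \<le> 1" "1 - l = V / (U + V)"
    using assms by (auto simp: l_def field_simps)
  have split: "u + v = (U + V) * (l * (u / U) + (1 - l) * (v / V))"
    unfolding l(3) using assms by (simp add: l_def distrib_left)
  have "(u + v) powr p = (U + V) powr p * (l * (u / U) + (1 - l) * (v / V)) powr p"
    unfolding split by (rule powr_mult)
  also have "\<dots> \<le> (U + V) powr p * (l * (u / U) powr p + (1 - l) * (v / V) powr p)"
    using assms l(1,2) by (intro mult_left_mono powr_convex_combination_le) auto
  finally show ?thesis
    unfolding l(3) using assms by (simp add: l_def powr_divide)
qed

lemma ennreal_powr_mono:
  assumes "0 \<le> q" "u \<le> v"
  shows "ennreal_powr u q \<le> ennreal_powr v q"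
proof (cases "v = \<infinity>")
  case False
  then have "enn2real u \<le> enn2real v" "u \<noteq> \<infinity>"
    using assms by (auto intro!: enn2real_mono simp: top.not_eq_extremum top_unique)
  then show ?thesis
    using False assms by (auto simp: ennreal_powr_def intro!: ennreal_leI powr_mono2)
qed (simp add: ennreal_powr_def)

text \<open>Minkowski's inequality for \<open>\<bar>h t\<bar> + c\<close>: the norm of the constant
  \<open>c\<close> over (a, b) is \<open>(b - a) powr (1 / p) * c\<close>.\<close>

lemma Lp_norm_le_add_const:
  fixes p a b c :: real and g h :: "real \<Rightarrow> real"
  assumes "1 \<le> p" "a \<le> b" "0 \<le> c"
    and meas: "h \<in> borel_measurable (lebesgue_on {a<..<b})"
    and le: "\<And>t. a < t \<Longrightarrow> t < b \<Longrightarrow> \<bar>g t\<bar> \<le> \<bar>h t\<bar> + c"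
  shows "Lp_norm p a b g \<le> Lp_norm p a b h + ennreal ((b - a) powr (1 / p) * c)"
proof (cases "Lp_norm p a b h = \<infinity>")
  case False
  note [measurable] = meas
  let ?M = "lebesgue_on {a<..<b}"
  define I where "I = (\<integral>\<^sup>+ t. ennreal (\<bar>h t\<bar> powr p) \<partial>?M)"
  define U where "U = enn2real I powr (1 / p)"
  define C where "C = (b - a) powr (1 / p) * c"
  have "I \<noteq> \<infinity>"
    using False by (auto simp: Lp_norm_def ennreal_powr_def I_def)
  have [simp]: "0 \<le> U" "0 \<le> C"
    using assms by (auto simp: U_def C_def)
  have Lp_h: "Lp_norm p a b h = ennreal U"
    using \<open>I \<noteq> \<infinity>\<close> by (simp add: Lp_norm_def ennreal_powr_def I_def U_def)
  have I: "I = ennreal (U powr p)"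
    using \<open>I \<noteq> \<infinity>\<close> assms(1) by (simp add: U_def powr_powr top.not_eq_extremum)
  have Cp: "c powr p * (b - a) = C powr p"
    using assms by (simp add: C_def powr_mult powr_powr)
  \<comment> \<open>Either of \<open>U\<close> and \<open>C\<close> may be 0, so the bound is first
    shown with a slack \<open>e\<close>, split evenly between the two.\<close>
  have "Lp_norm p a b g \<le> ennreal U + ennreal C + ennreal e" if "0 < e" for e
  proof -
    \<comment> \<open>The weights of the convexity inequality must be positive.\<close>
    define U' C' where "U' = U + e / 2" and "C' = C + e / 2"
    have pos: "0 < U'" "0 < C'" "U \<le> U'" "C \<le> C'"
      using that by (auto simp: U'_def C'_def intro: add_nonneg_pos)
    define k where "k = (U' + C') powr p"
    \<comment> \<open>The coefficients that \<open>powr_add_le_weighted\<close> gives to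
      \<open>\<bar>h t\<bar> powr p\<close> and \<open>c powr p\<close>; they are independent of
      \<open>t\<close>.\<close>
    define A B where "A = k * (U' / (U' + C')) / U' powr p"
      and "B = k * (C' / (U' + C')) / C' powr p"
    have AB: "0 \<le> A" "0 \<le> B" "0 \<le> k"
      using pos by (auto simp: A_def B_def k_def)
    have ptw: "\<bar>g t\<bar> powr p \<le> A * \<bar>h t\<bar> powr p + B * c powr p" if "a < t" "t < b" for t
    proof -
      have "\<bar>g t\<bar> powr p \<le> (\<bar>h t\<bar> + c) powr p"
        using le[OF that] assms(1) by (intro powr_mono2) auto
      also have "\<dots> \<le> A * \<bar>h t\<bar> powr p + B * c powr p"
        using powr_add_le_weighted[of p "\<bar>h t\<bar>" c U' C'] assms pos
        by (simp add: A_def B_def k_def algebra_simps)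
      finally show ?thesis .
    qed
    have "(\<integral>\<^sup>+ t. ennreal (\<bar>g t\<bar> powr p) \<partial>?M)
            \<le> (\<integral>\<^sup>+ t. ennreal A * ennreal (\<bar>h t\<bar> powr p) + ennreal (B * c powr p) \<partial>?M)"
      using ptw AB
      by (intro nn_integral_mono)
         (auto simp: space_restrict_space ennreal_leI simp flip: ennreal_mult ennreal_plus)
    also have "\<dots> = ennreal A * I + ennreal (B * c powr p) * emeasure ?M (space ?M)"
      by (subst nn_integral_add) (auto simp: nn_integral_cmult I_def)
    also have "emeasure ?M (space ?M) = ennreal (b - a)"
      using assms(2) by (simp add: space_restrict_space emeasure_restrict_space)
    also have "ennreal A * I + ennreal (B * c powr p) * ennreal (b - a)
                 = ennreal (A * U powr p + B * C powr p)"
      using AB assms(2) by (simp add: I mult.assoc flip: ennreal_mult ennreal_plus Cp)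
    also have "\<dots> \<le> ennreal k"
    proof (rule ennreal_leI)
      \<comment> \<open>Passing to the larger \<open>U'\<close> and \<open>C'\<close> cancels the
        denominators in \<open>A\<close> and \<open>B\<close>; the two weights then add up to
        1.\<close>
      have "A * U powr p + B * C powr p \<le> A * U' powr p + B * C' powr p"
        using AB pos assms(1) by (intro add_mono mult_left_mono powr_mono2) auto
      also have "\<dots> = k * (U' / (U' + C')) + k * (C' / (U' + C'))"
        using pos by (simp add: A_def B_def)
      also have "\<dots> = k * ((U' + C') / (U' + C'))"
        by (simp only: distrib_left add_divide_distrib)
      also have "(U' + C') / (U' + C') = 1"
        using pos by simp
      finally show "A * U powr p + B * C powr p \<le> k"
        by simp
    qed
    finally have "Lp_norm p a b g \<le> ennreal_powr (ennreal k) (1 / p)"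
      unfolding Lp_norm_def using assms(1) by (intro ennreal_powr_mono) auto
    also have "\<dots> = ennreal (U' + C')"
      using AB pos assms(1) by (simp add: ennreal_powr_def k_def powr_powr)
    also have "\<dots> = ennreal U + ennreal C + ennreal e"
      using that by (simp add: U'_def C'_def flip: ennreal_plus)
    finally show ?thesis .
  qed
  then show ?thesis
    unfolding Lp_h C_def[symmetric] by (rule ennreal_le_epsilon)
qed simp

text \<open>The essential supremum of \<open>\<bar>h t\<bar>\<close> bounds it almost everywhere, so
  adding \<open>c\<close> bounds \<open>\<bar>g t\<bar>\<close> almost everywhere. Measurability of
  \<open>g\<close> matters because \<open>esssup\<close> is \<open>top\<close> on non-measurable
  functions.\<close>

lemma Linf_norm_le_add_const:
  assumes "g \<in> borel_measurable (lebesgue_on {a<..<b})" "0 \<le> c"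
    and "\<And>t. a < t \<Longrightarrow> t < b \<Longrightarrow> \<bar>g t\<bar> \<le> \<bar>h t\<bar> + c"
  shows "Linf_norm a b g \<le> Linf_norm a b h + ennreal c"
  unfolding Linf_norm_def
proof (rule esssup_I)
  show "(\<lambda>t. ennreal \<bar>g t\<bar>) \<in> borel_measurable (lebesgue_on {a<..<b})"
    using assms(1) by measurable
  have ptw: "ennreal \<bar>g t\<bar> \<le> ennreal \<bar>h t\<bar> + ennreal c" if "t \<in> space (lebesgue_on {a<..<b})" for t
    using that assms(2,3) by (auto simp: space_restrict_space ennreal_leI simp flip: ennreal_plus)
  show "AE t in lebesgue_on {a<..<b}.
          ennreal \<bar>g t\<bar> \<le> esssup (lebesgue_on {a<..<b}) (\<lambda>t. ennreal \<bar>h t\<bar>) + ennreal c"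
    using esssup_AE[of "\<lambda>t. ennreal \<bar>h t\<bar>" "lebesgue_on {a<..<b}"] AE_space
    by eventually_elim (meson ptw add_right_mono order_trans)
qed

text \<open>Monotone functions are Borel on \<open>A\<close>; composing with the identity passes to
  the finer Lebesgue sigma-algebra.\<close>

lemma mono_on_imp_measurable_lebesgue_on:
  fixes g :: "real \<Rightarrow> real"
  assumes "mono_on A g"
  shows "g \<in> borel_measurable (lebesgue_on A)"
proof -
  have "id \<in> measurable (lebesgue_on A) (restrict_space borel A)"
    by (intro measurable_restrict_space2 measurable_restrict_space1)
       (auto simp: space_restrict_space)
  from measurable_compose[OF this borel_measurable_mono_on_fnc[OF assms]] show ?thesis
    by simp
qed

section \<open>Moduli of continuity of maps with bounded image\<close>

context
  fixes S :: "'a::metric_space set" and f :: "'a \<Rightarrow> 'b::metric_space"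
  assumes bounded_image: "bounded (f ` S)"
begin

text \<open>The diameter of the bounded image is an upper bound for the distances, so the real
  \<open>Sup\<close> is a genuine supremum.\<close>

lemma dist_le_modulus:
  assumes "y \<in> S" "z \<in> S" "ereal (dist y z) \<le> t"
  shows "dist (f y) (f z) \<le> modulus_of_continuity S f t"
  unfolding modulus_of_continuity_def
proof (rule cSup_upper)
  show "bdd_above {dist (f x) (f x') |x x'. x \<in> S \<and> x' \<in> S \<and> ereal (dist x x') \<le> t}"
    using bounded_image by (auto intro!: bdd_aboveI[of _ "diameter (f ` S)"] diameter_bounded_bound)
qed (use assms in auto)

text \<open>A diagonal pair has distance 0 and is admissible as \<open>0 \<le> t\<close>, so the
  supremum is not over the empty set.\<close>

lemma modulus_le:
  assumes "S \<noteq> {}" "0 \<le> t"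
    and "\<And>y z. y \<in> S \<Longrightarrow> z \<in> S \<Longrightarrow> ereal (dist y z) \<le> t \<Longrightarrow> dist (f y) (f z) \<le> B"
  shows "modulus_of_continuity S f t \<le> B"
  unfolding modulus_of_continuity_def
proof (rule cSup_least)
  obtain y where "y \<in> S" using assms(1) by blast
  then have "ereal (dist y y) \<le> t" using assms(2) by (simp add: zero_ereal_def)
  with \<open>y \<in> S\<close> show "{dist (f x) (f x') |x x'. x \<in> S \<and> x' \<in> S \<and> ereal (dist x x') \<le> t} \<noteq> {}"
    by blast
qed (use assms(3) in auto)

lemma modulus_mono:
  assumes "S \<noteq> {}" "0 \<le> s" "s \<le> t"
  shows "modulus_of_continuity S f s \<le> modulus_of_continuity S f t"
  using assms by (intro modulus_le dist_le_modulus) auto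

lemma modulus_nonneg:
  assumes "S \<noteq> {}" "0 \<le> t"
  shows "0 \<le> modulus_of_continuity S f t"
proof -
  obtain y where "y \<in> S" using assms(1) by blast
  then show ?thesis using dist_le_modulus[of y y t] assms(2) by (simp add: zero_ereal_def)
qed

end

section \<open>Comparison with the discrete modulus\<close>

lemma finite_dist_set:
  assumes "finite X"
  shows "finite {dist (f x) (f x') |x x'. x \<in> X \<and> x' \<in> X \<and> P x x'}"
  by (rule finite_subset[of _ "(\<lambda>(x, x'). dist (f x) (f x')) ` (X \<times> X)"]) (use assms in auto)

text \<open>A finite nonempty set has its maximum as supremum. This carries the bounds and
  monotonicity above over to the discrete modulus.\<close>

lemma discrete_modulus_eq:
  assumes "finite X" "X \<noteq> {}" "0 \<le> t"
  shows "discrete_modulus X f t = modulus_of_continuity X f t"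
  unfolding discrete_modulus_def modulus_of_continuity_def
proof (rule cSup_eq_Max[symmetric])
  obtain y where "y \<in> X" using assms(2) by blast
  moreover from this have "ereal (dist y y) \<le> t" using assms(3) by (simp add: zero_ereal_def)
  ultimately show "{dist (f x) (f x') |x x'. x \<in> X \<and> x' \<in> X \<and> ereal (dist x x') \<le> t} \<noteq> {}"
    by blast
qed (rule finite_dist_set[OF assms(1)])

lemma modulus_le_net_modulus:
  assumes bdd: "bounded (f ` S)" and "S \<noteq> {}" and net: "eps_net S (r / 2) K" and "0 \<le> r" "r \<le> t"
  shows "modulus_of_continuity S f (ereal (t - r))
           \<le> modulus_of_continuity K f (ereal t) + 2 * modulus_of_continuity S f (ereal r)"
proof (rule modulus_le[OF bdd \<open>S \<noteq> {}\<close>])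
  fix y z assume y: "y \<in> S" and z: "z \<in> S" and yz: "ereal (dist y z) \<le> ereal (t - r)"
  have "K \<subseteq> S" using net by (simp add: eps_net_def)
  obtain y' where y': "y' \<in> K" "dist y' y \<le> r / 2"
    using net y unfolding eps_net_def by (meson mem_cball)
  obtain z' where z': "z' \<in> K" "dist z' z \<le> r / 2"
    using net z unfolding eps_net_def by (meson mem_cball)
  have "dist y' z' \<le> dist y' y + dist y z + dist z z'"
    using dist_triangle[of y' z' y] dist_triangle[of y z' z] by linarith
  \<comment> \<open>The two displacements of at most \<open>r / 2\<close> use up exactly the shift
    by \<open>r\<close>.\<close>
  also have "\<dots> \<le> t"
    using y'(2) z'(2) yz by (simp add: dist_commute)
  finally have "dist (f y') (f z') \<le> modulus_of_continuity K f (ereal t)"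
    using bounded_subset[OF bdd image_mono[OF \<open>K \<subseteq> S\<close>]] y'(1) z'(1)
    by (intro dist_le_modulus) auto
  moreover have "dist (f y) (f y') \<le> modulus_of_continuity S f (ereal r)"
    "dist (f z') (f z) \<le> modulus_of_continuity S f (ereal r)"
    using y y' z z' \<open>K \<subseteq> S\<close> \<open>0 \<le> r\<close>
    by (auto intro!: dist_le_modulus[OF bdd] simp: dist_commute)
  ultimately show "dist (f y) (f z)
      \<le> modulus_of_continuity K f (ereal t) + 2 * modulus_of_continuity S f (ereal r)"
    using dist_triangle[of "f y" "f z" "f y'"] dist_triangle[of "f y'" "f z" "f z'"] by linarith
qed (use assms in simp)

theorem theorem3p9:
  fixes S :: "'a::metric_space set" and f :: "'a \<Rightarrow> 'b::metric_space"
    and a b r :: real and N :: nat and x :: "nat \<Rightarrow> 'a"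
  assumes "compact S"
    and "continuous_on S f"
    and "a \<le> b" and "{a..b} \<subseteq> {0<..diameter S}"
    and "0 < r" and "r \<le> a"
    and "enat N \<ge> covering_number S (r / 2)"
    and "eps_net S (r / 2) (x ` {1..N})"
  shows "(\<forall>p\<ge>1.
            Lp_norm p a b (\<lambda>t. modulus_of_continuity S f (ereal t)
                              - discrete_modulus (x ` {1..N}) f (ereal t))
            \<le> ennreal (2 powr ((p - 1) / p))
                * Lp_norm p a b (\<lambda>t. modulus_of_continuity S f (ereal t)
                                    - modulus_of_continuity S f (ereal (t - r)))
              + ennreal (2 * (b - a) powr (1 / p) * modulus_of_continuity S f (ereal r)))
       \<and> Linf_norm a b (\<lambda>t. modulus_of_continuity S f (ereal t)
                           - discrete_modulus (x ` {1..N}) f (ereal t))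
         \<le> Linf_norm a b (\<lambda>t. modulus_of_continuity S f (ereal t)
                             - modulus_of_continuity S f (ereal (t - r)))
           + ennreal (2 * modulus_of_continuity S f (ereal r))"
proof -
  let ?X = "x ` {1..N}"
  let ?w = "\<lambda>t. modulus_of_continuity S f (ereal t)"
  let ?g = "\<lambda>t. ?w t - discrete_modulus ?X f (ereal t)"
  let ?h = "\<lambda>t. ?w t - ?w (t - r)"
  have bdd: "bounded (f ` S)"
    using assms(1,2) by (simp add: compact_continuous_image compact_imp_bounded)
  \<comment> \<open>The empty set has diameter 0, which would leave no room for
    \<open>a\<close>.\<close>
  have "a \<in> {0<..diameter S}" using assms(3,4) by auto
  then have "S \<noteq> {}" by auto
  have "?X \<subseteq> S" using assms(8) by (simp add: eps_net_def)
  have "?X \<noteq> {}" using assms(8) \<open>S \<noteq> {}\<close> unfolding eps_net_def by fast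
  have bddX: "bounded (f ` ?X)" using bdd \<open>?X \<subseteq> S\<close> by (meson bounded_subset image_mono)
  have discrete: "discrete_modulus ?X f (ereal t) = modulus_of_continuity ?X f (ereal t)" if "0 \<le> t" for t
    using that \<open>?X \<noteq> {}\<close> by (intro discrete_modulus_eq) auto
  have w_nonneg: "0 \<le> ?w r"
    using assms(5) by (intro modulus_nonneg[OF bdd \<open>S \<noteq> {}\<close>]) simp
  have meas_w: "?w \<in> borel_measurable (lebesgue_on {a<..<b})"
    using assms by (intro mono_on_imp_measurable_lebesgue_on mono_onI modulus_mono[OF bdd \<open>S \<noteq> {}\<close>]) auto
  \<comment> \<open>Since \<open>r \<le> a\<close>, the scale \<open>t - r\<close> stays nonnegative
    on (a, b), where the modulus is monotone.\<close>
  have meas_shift: "(\<lambda>t. ?w (t - r)) \<in> borel_measurable (lebesgue_on {a<..<b})"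
    using assms by (intro mono_on_imp_measurable_lebesgue_on mono_onI modulus_mono[OF bdd \<open>S \<noteq> {}\<close>]) auto
  have meas_discrete: "(\<lambda>t. discrete_modulus ?X f (ereal t)) \<in> borel_measurable (lebesgue_on {a<..<b})"
    using assms discrete
    by (intro mono_on_imp_measurable_lebesgue_on mono_onI)
       (auto intro!: modulus_mono[OF bddX \<open>?X \<noteq> {}\<close>, simplified])
  have ptw: "\<bar>?g t\<bar> \<le> \<bar>?h t\<bar> + 2 * ?w r" if "a < t" "t < b" for t
  proof -
    have t: "0 \<le> t" "r \<le> t" using that assms(5,6) by auto
    \<comment> \<open>Pairs of net points are pairs in \<open>S\<close>, so \<open>?g t\<close> is
      nonnegative and only its upper bound is at stake.\<close>
    have "modulus_of_continuity ?X f (ereal t) \<le> ?w t"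
      using t \<open>?X \<subseteq> S\<close> by (intro modulus_le[OF bddX \<open>?X \<noteq> {}\<close>] dist_le_modulus[OF bdd]) auto
    with modulus_le_net_modulus[OF bdd \<open>S \<noteq> {}\<close> assms(8) _ t(2)] assms(5) show ?thesis
      unfolding discrete[OF t(1)] by linarith
  qed
  have "Lp_norm p a b ?g \<le> ennreal (2 powr ((p - 1) / p)) * Lp_norm p a b ?h
          + ennreal (2 * (b - a) powr (1 / p) * ?w r)" if "1 \<le> p" for p
  proof -
    have const: "2 * (b - a) powr (1 / p) * ?w r = (b - a) powr (1 / p) * (2 * ?w r)"
      by simp
    have "1 \<le> 2 powr ((p - 1) / p)"
      using that by (simp add: ge_one_powr_ge_zero)
    then have factor: "Lp_norm p a b ?h \<le> ennreal (2 powr ((p - 1) / p)) * Lp_norm p a b ?h"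
      using mult_right_mono[of 1 "ennreal (2 powr ((p - 1) / p))" "Lp_norm p a b ?h"] by simp
    have "Lp_norm p a b ?g \<le> Lp_norm p a b ?h + ennreal (2 * (b - a) powr (1 / p) * ?w r)"
      unfolding const using that assms(3) w_nonneg meas_w meas_shift
      by (intro Lp_norm_le_add_const ptw borel_measurable_diff) auto
    then show ?thesis
      using add_right_mono[OF factor] by (rule order_trans)
  qed
  moreover have "Linf_norm a b ?g \<le> Linf_norm a b ?h + ennreal (2 * ?w r)"
    using w_nonneg meas_w meas_discrete
    by (intro Linf_norm_le_add_const ptw borel_measurable_diff) auto
  ultimately show ?thesis
    by blast
qed

end
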